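(* The elements of $\langle \Im(I_n^{2,i}) \rangle$ are distributed almost uniformly in the unit interval for sufficiently large $n$.
   Context: For a positive integer $c$, $\sqrt{-c}$ denotes $\sqrt{c}\,\sqrt{-1}$ (the root with positive imaginary part), and likewise $\sqrt{1-4c} = \sqrt{4c-1}\,\sqrt{-1}$. For an integer $n \ge 1$ define $$I_n^{2,i} := \left\{\tfrac{1+\sqrt{1-4c}}{2} \in \mathbb{C}\setminus\mathbb{R} \;\middle|\; c \in \mathbb{Z},\ \left(\tfrac{n-1}{2}\right)^2+1 \le c \le \left(\tfrac{n+1}{2}\right)^2\right\} \quad \text{if } n \text{ is odd},$$ $$I_n^{2,i} := \left\{\sqrt{-c} \in \mathbb{C}\setminus\mathbb{R} \;\middle|\; c \in \mathbb{Z},\ \left(\tfrac{n}{2}\right)^2 < c < \left(\tfrac{n}{2}+1\right)^2\right\} \quad \text{if } n \text{ is even}.$$ For a real number $x$, $\langle x\rangle := x - \lfloor x \rfloor$. For $S \subset \mathbb{C}\setminus\mathbb{R}$, $\langle \Im(S)\rangle := \{\langle \Im(\alpha)\rangle \mid \alpha \in S\}$, where $\Im$ is the imaginary part. Almost uniformity: let $S_1, S_2, \dots$ be a family of finite sets in $[0,1]$, where $S_N$ has $N$ elements $x_1 < x_2 < \dots < x_N$, and put $\Delta_i := x_{i+1}-x_i$ for $i \in \{1,\dots,N-1\}$. Suppose there is a constant $C$ independent of $N$ such that $\max_{1 \le i \le N-1} \left|\Delta_i - \frac{1}{N}\right| \le \frac{C}{N^2}$ for all $N$. Then the elements of $S_N$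 are said to be distributed almost uniformly in the unit interval if $N \ge 2C$; without specifying $C$, one says that the elements of $S_N$ are distributed almost uniformly in the unit interval for sufficiently large $N$. Thus the assertion "almost uniformly for sufficiently large $N$" means that such a constant $C$ exists. Here the family is $S_n = \langle \Im(I_n^{2,i})\rangle$, $n = 1,2,\dots$, where $S_n$ has $n$ elements. *)

theory Defs
  imports Complex_Main
begin

text \<open>
  In both cases the argument of \<^const>\<open>csqrt\<close> is a negative real number, where the principal
  square root is the one with positive imaginary part.
\<close>

definition imag_quadratic_ints :: "nat \<Rightarrow> complex set" where
  "imag_quadratic_ints n =
     (if odd n
      then {(1 + csqrt (1 - 4 * of_int c)) / 2 | c :: int.
              ((real n - 1) / 2)^2 + 1 \<le> of_int c \<and> of_int c \<le> ((real n + 1) / 2)^2}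
      else {csqrt (- of_int c) | c :: int.
              (real n / 2)^2 < of_int c \<and> of_int c < (real n / 2 + 1)^2}) - \<real>"

definition frac_Im :: "complex set \<Rightarrow> real set" where
  "frac_Im S = {frac (Im z) | z. z \<in> S}"

text \<open>
  The family is indexed by the positive integers; the value \<open>S 0\<close> is irrelevant. The
  increasing enumeration of \<open>S N\<close> is 0-based, and for \<open>N = 1\<close> there are no gaps to bound.
  A family with \<open>almost_uniform_with C S\<close> counts as almost uniformly distributed at the
  indices \<open>N \<ge> 2 * C\<close>, so that the existence of some \<open>C\<close> is what
  \<^emph>\<open>for sufficiently large\<close> \<open>N\<close> means.
\<close>

definition almost_uniform_with :: "real \<Rightarrow> (nat \<Rightarrow> real set) \<Rightarrow> bool" where
  "almost_uniform_with C S \<longleftrightarrow>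
     (\<forall>N\<ge>1. finite (S N) \<and> card (S N) = N \<and> S N \<subseteq> {0..1} \<and>
        (let x = sorted_list_of_set (S N)
         in \<forall>i < N - 1. \<bar>(x ! (i + 1) - x ! i) - 1 / real N\<bar> \<le> C / (real N)^2))"

definition almost_uniform_for_large :: "(nat \<Rightarrow> real set) \<Rightarrow> bool" where
  "almost_uniform_for_large S \<longleftrightarrow> (\<exists>C. almost_uniform_with C S)"

end

theory Submission
  imports Defs
begin

text \<open>
  Write \<open>m = \<lfloor>n/2\<rfloor>\<close>. In both parities the fractional parts are \<open>sqrt (m\<^sup>2 + \<delta> + i) - m\<close> for
  \<open>i < n\<close>, with \<open>\<delta> = 3/4\<close> for odd and \<open>\<delta> = 1\<close> for even \<open>n\<close>, and all square roots lie strictly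
  between \<open>m\<close> and \<open>m + 1\<close>. A gap is therefore the reciprocal of a sum \<open>D\<close> of two of these roots,
  and \<open>D\<close> differs from \<open>n\<close> by a bounded amount, so that \<open>1/D - 1/n = (n - D)/(D n)\<close> is of order
  \<open>1/n\<^sup>2\<close>.
\<close>

lemma sorted_list_of_set_image_lessThan:
  fixes f :: "nat \<Rightarrow> 'a::linorder"
  assumes "strict_mono_on {..<n} f"
  shows "sorted_list_of_set (f ` {..<n}) = map f [0..<n]"
proof -
  have "sorted_wrt (<) (map f [0..<n])"
    using assms by (auto simp: sorted_wrt_iff_nth_less strict_mono_on_def)
  moreover have "set (map f [0..<n]) = f ` {..<n}"
    by (simp add: atLeast0LessThan)
  moreover have "finite (f ` {..<n})"
    by simp
  ultimately show ?thesis
    by (metis strict_sorted_list_of_set sorted_list_of_set.set_sorted_key_list_of_set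
        strict_sorted_equal)
qed

text \<open>A strictly increasing enumeration \<open>f N\<close> on \<open>{..<N}\<close> is
  injective, which gives the cardinality, and lists its image in sorted order. The gaps become
  differences of consecutive values of \<open>f N\<close>.\<close>

lemma almost_uniform_withI:
  assumes "\<And>N. N \<ge> 1 \<Longrightarrow> S N = f N ` {..<N}"
    and "\<And>N. strict_mono_on {..<N} (f N)"
    and "\<And>N i. i < N \<Longrightarrow> f N i \<in> {0..1}"
    and "\<And>N i. i + 1 < N \<Longrightarrow> \<bar>(f N (i + 1) - f N i) - 1 / real N\<bar> \<le> C / (real N)^2"
  shows "almost_uniform_with C S"
  unfolding almost_uniform_with_def
proof (intro allI impI)
  fix N :: nat
  assume "N \<ge> 1"
  then have S: "S N = f N ` {..<N}"
    by (rule assms(1))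
  have "card (S N) = N"
    unfolding S using card_image[OF strict_mono_on_imp_inj_on[OF assms(2)]] by simp
  moreover have "sorted_list_of_set (S N) = map (f N) [0..<N]"
    unfolding S by (rule sorted_list_of_set_image_lessThan[OF assms(2)])
  moreover have "S N \<subseteq> {0..1}"
    unfolding S using assms(3) by blast
  ultimately show "finite (S N) \<and> card (S N) = N \<and> S N \<subseteq> {0..1} \<and>
      (let x = sorted_list_of_set (S N)
       in \<forall>i < N - 1. \<bar>(x ! (i + 1) - x ! i) - 1 / real N\<bar> \<le> C / (real N)^2)"
    using assms(4)[of _ N] S by (auto simp: Let_def)
qed

lemma sqrt_diff_Suc:
  fixes x :: real
  assumes "x \<ge> 0"
  shows "sqrt (x + 1) - sqrt x = 1 / (sqrt (x + 1) + sqrt x)"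
proof -
  have "(sqrt (x + 1) - sqrt x) * (sqrt (x + 1) + sqrt x) = 1"
    using assms by (simp add: algebra_simps flip: power2_eq_square)
  moreover have "sqrt (x + 1) + sqrt x > 0"
    using assms by (intro add_pos_nonneg) auto
  ultimately show ?thesis
    by (simp add: field_simps)
qed

text \<open>The difference is \<open>(N - D) / (D * N)\<close>; the last hypothesis is the desired
  bound cleared of denominators.\<close>

lemma abs_inverse_diff_le:
  fixes D N C :: real
  assumes "D > 0" "N > 0" "\<bar>N - D\<bar> * N \<le> C * D"
  shows "\<bar>1 / D - 1 / N\<bar> \<le> C / N^2"
proof -
  have "\<bar>1 / D - 1 / N\<bar> = \<bar>N - D\<bar> * N / (D * N^2)"
    using assms(1,2) by (simp add: diff_divide_eq_iff divide_diff_eq_iff abs_mult power2_eq_square)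
  also have "\<dots> \<le> C * D / (D * N^2)"
    using assms by (intro divide_right_mono) auto
  finally show ?thesis
    using assms(1) by simp
qed

text \<open>With \<open>c = m^2 + 1 + i\<close> and \<open>m = n div 2\<close>, the imaginary part
  is \<open>sqrt c\<close> for even \<open>n\<close> and
  \<open>sqrt (4 * c - 1) / 2 = sqrt (c - 1 / 4)\<close> for odd \<open>n\<close>, whence 1 and
  3/4.\<close>

definition parity_offset :: "nat \<Rightarrow> real" where
  "parity_offset n = (if odd n then 3 / 4 else 1)"

definition root_im :: "nat \<Rightarrow> nat \<Rightarrow> real" where
  "root_im n i = sqrt ((real (n div 2))^2 + parity_offset n + real i)"

lemma root_im_gt: "root_im n i > real (n div 2)"
  unfolding root_im_def by (rule real_less_rsqrt) (simp add: parity_offset_def)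

text \<open>At the last index \<open>i = n - 1\<close> the radicand is
  \<open>(m + 1)^2 - 1 / 4\<close> for odd \<open>n\<close> and \<open>(m + 1)^2 - 1\<close> for
  even \<open>n\<close>, where \<open>m = n div 2\<close>.\<close>

lemma root_im_lt:
  assumes "i < n"
  shows "root_im n i < real (n div 2) + 1"
proof -
  have "real i + 1 \<le> real n"
    using assms by linarith
  moreover have "real n = 2 * real (n div 2) + (if odd n then 1 else 0)"
    by (auto elim!: evenE oddE)
  ultimately have "(real (n div 2))^2 + parity_offset n + real i < (real (n div 2) + 1)^2"
    by (auto simp: parity_offset_def power2_sum split: if_splits)
  then show ?thesis
    unfolding root_im_def by (intro real_less_lsqrt) auto
qed

lemma frac_root_im:
  assumes "i < n"
  shows "frac (root_im n i) = root_im n i - real (n div 2)"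
proof -
  have "\<lfloor>root_im n i\<rfloor> = int (n div 2)"
    using root_im_gt[of n i] root_im_lt[OF assms] by (intro floor_unique) auto
  then show ?thesis
    by (simp add: frac_def)
qed

lemma root_im_gap:
  assumes "i + 1 < n"
  shows "\<bar>(root_im n (i + 1) - root_im n i) - 1 / real n\<bar> \<le> 2 / (real n)^2"
proof -
  define m where "m = real (n div 2)"
  define D where "D = root_im n (i + 1) + root_im n i"
  have D: "2 * m < D" "D < 2 * m + 2"
    using root_im_gt[of n i] root_im_gt[of n "i + 1"] root_im_lt[of i n] root_im_lt[of "i + 1" n]
      assms unfolding D_def m_def by linarith+
  \<comment> \<open>A gap exists only for \<open>n \<ge> 2\<close>. This makes \<open>D\<close>
    positive and, for odd \<open>n\<close>, gives
    \<open>2 * m + 1 \<le> 4 * m < 2 * D\<close>.\<close>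
  have m: "m \<ge> 1"
    using assms unfolding m_def by simp
  have "\<bar>real n - D\<bar> * real n \<le> 2 * D"
  proof (cases "odd n")
    case True
    then have n: "real n = 2 * m + 1"
      unfolding m_def by (auto elim!: oddE)
    \<comment> \<open>Here \<open>n\<close> is the midpoint of the interval from
      \<open>2 * m\<close> to \<open>2 * m + 2\<close> that contains \<open>D\<close>.\<close>
    have "\<bar>real n - D\<bar> * real n \<le> 1 * real n"
      using D n by (intro mult_right_mono) auto
    then show ?thesis
      using D n m by linarith
  next
    case False
    then have n: "real n = 2 * m"
      unfolding m_def by (auto elim!: evenE)
    \<comment> \<open>Now \<open>n\<close> is the left endpoint of that interval, so the distance is
      only bounded by 2, but \<open>n < D\<close>.\<close>
    have "\<bar>real n - D\<bar> * real n \<le> 2 * real n"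
      using D n by (intro mult_right_mono) auto
    then show ?thesis
      using D n by linarith
  qed
  then have "\<bar>1 / D - 1 / real n\<bar> \<le> 2 / (real n)^2"
    using D m assms by (intro abs_inverse_diff_le) auto
  moreover have "root_im n (i + 1) - root_im n i = 1 / D"
    using sqrt_diff_Suc[of "(real (n div 2))^2 + parity_offset n + real i"]
    by (simp add: D_def root_im_def parity_offset_def add_ac)
  ultimately show ?thesis
    by simp
qed

lemma csqrt_neg_of_real:
  assumes "x \<ge> 0"
  shows "csqrt (- complex_of_real x) = \<i> * complex_of_real (sqrt x)"
  using csqrt_of_real_nonpos[of "complex_of_real (- x)"] assms by simp

lemma int_interval_eq_image:
  "{a<..a + int n} = (\<lambda>i. a + 1 + int i) ` {..<n}"
proof (intro equalityI subsetI)
  fix c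
  assume "c \<in> {a<..a + int n}"
  then show "c \<in> (\<lambda>i. a + 1 + int i) ` {..<n}"
    by (intro image_eqI[of _ _ "nat (c - a - 1)"]) auto
qed auto

lemma imag_quadratic_ints_odd:
  assumes "odd n"
  shows "imag_quadratic_ints n = (\<lambda>i. Complex (1 / 2) (root_im n i)) ` {..<n}"
proof -
  define m where "m = n div 2"
  have n: "n = 2 * m + 1"
    using assms by (simp add: m_def)
  have "(((real n - 1) / 2)^2 + 1 \<le> of_int c \<and> of_int c \<le> ((real n + 1) / 2)^2) \<longleftrightarrow>
      c \<in> {(int m)^2<..(int m)^2 + int n}" for c
  proof -
    \<comment> \<open>Both bounds are integers, so the condition on \<open>c\<close> can be read off
      in \<open>int\<close>; the upper one is \<open>(m + 1)^2 = m^2 + n\<close>.\<close>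
    have "((real n - 1) / 2)^2 + 1 = of_int ((int m)^2 + 1)"
      by (simp add: n)
    moreover have "((real n + 1) / 2)^2 = of_int ((int m)^2 + int n)"
      by (simp add: n power2_eq_square field_simps)
    ultimately show ?thesis
      by (simp only: of_int_le_iff greaterThanAtMost_iff) linarith
  qed
  then have "imag_quadratic_ints n =
      (\<lambda>i. (1 + csqrt (1 - 4 * of_int ((int m)^2 + 1 + int i))) / 2) ` {..<n} - \<real>"
    unfolding imag_quadratic_ints_def
    by (simp only: assms simp_thms if_True int_interval_eq_image Setcompr_eq_image image_image)
  moreover have "(1 + csqrt (1 - 4 * of_int ((int m)^2 + 1 + int i))) / 2
      = Complex (1 / 2) (root_im n i)" for i
  proof -
    define y where "y = (real m)^2 + 3 / 4 + real i"
    then have y_nonneg: "y \<ge> 0"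
      by simp
    have "1 - 4 * of_int ((int m)^2 + 1 + int i) = - complex_of_real (4 * y)"
      by (simp add: y_def)
    moreover have "sqrt (4 * y) = 2 * root_im n i"
      unfolding real_sqrt_mult using assms
      by (simp add: y_def root_im_def parity_offset_def m_def)
    ultimately show ?thesis
      by (simp add: csqrt_neg_of_real complex_eq_iff y_nonneg del: of_real_mult)
  qed
  \<comment> \<open>The imaginary parts are positive, so removing the reals loses no
    element.\<close>
  moreover have "Complex (1 / 2) (root_im n i) \<notin> \<real>" for i
    using root_im_gt[of n i] by (auto simp: complex_is_Real_iff)
  ultimately show ?thesis
    by auto
qed

lemma imag_quadratic_ints_even:
  assumes "even n"
  shows "imag_quadratic_ints n = (\<lambda>i. Complex 0 (root_im n i)) ` {..<n}"
proof -
  define m where "m = n div 2"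
  have n: "n = 2 * m"
    using assms by (simp add: m_def)
  have "((real n / 2)^2 < of_int c \<and> of_int c < (real n / 2 + 1)^2) \<longleftrightarrow>
      c \<in> {(int m)^2<..(int m)^2 + int n}" for c
  proof -
    have "(real n / 2)^2 = of_int ((int m)^2)"
      by (simp add: n)
    \<comment> \<open>The upper bound is strict here, so the largest admissible \<open>c\<close> is
      again \<open>m^2 + n\<close>.\<close>
    moreover have "(real n / 2 + 1)^2 = of_int ((int m)^2 + int n + 1)"
      by (simp add: n power2_eq_square field_simps)
    ultimately show ?thesis
      by (simp only: of_int_less_iff greaterThanAtMost_iff) linarith
  qed
  then have "imag_quadratic_ints n =
      (\<lambda>i. csqrt (- of_int ((int m)^2 + 1 + int i))) ` {..<n} - \<real>"
    unfolding imag_quadratic_ints_def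
    by (simp only: assms simp_thms if_False int_interval_eq_image Setcompr_eq_image image_image)
  moreover have "csqrt (- of_int ((int m)^2 + 1 + int i)) = Complex 0 (root_im n i)" for i
    using assms csqrt_neg_of_real[of "(real m)^2 + 1 + real i"]
    by (simp add: root_im_def parity_offset_def m_def complex_eq_iff)
  moreover have "Complex 0 (root_im n i) \<notin> \<real>" for i
    using root_im_gt[of n i] by (auto simp: complex_is_Real_iff)
  ultimately show ?thesis
    by auto
qed

lemma frac_Im_imag_quadratic_ints:
  "frac_Im (imag_quadratic_ints n) = (\<lambda>i. root_im n i - real (n div 2)) ` {..<n}"
proof -
  have "frac_Im (imag_quadratic_ints n) = (\<lambda>i. frac (root_im n i)) ` {..<n}"
    unfolding frac_Im_def Setcompr_eq_image
    by (cases "odd n")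
      (simp_all add: imag_quadratic_ints_odd imag_quadratic_ints_even image_image)
  then show ?thesis
    by (simp add: frac_root_im)
qed

theorem theorem6: "almost_uniform_for_large (\<lambda>n. frac_Im (imag_quadratic_ints n))"
proof -
  have "almost_uniform_with 2 (\<lambda>n. frac_Im (imag_quadratic_ints n))"
  proof (rule almost_uniform_withI)
    fix n i :: nat
    show "frac_Im (imag_quadratic_ints n) = (\<lambda>i. root_im n i - real (n div 2)) ` {..<n}"
      by (rule frac_Im_imag_quadratic_ints)
    show "strict_mono_on {..<n} (\<lambda>i. root_im n i - real (n div 2))"
      by (auto simp: strict_mono_on_def root_im_def)
    show "root_im n i - real (n div 2) \<in> {0..1}" if "i < n"
      using root_im_gt[of n i] root_im_lt[OF that] by auto
    show "\<bar>(root_im n (i + 1) - real (n div 2)) - (root_im n i - real (n div 2)) - 1 / real n\<bar>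
        \<le> 2 / (real n)^2" if "i + 1 < n"
      using root_im_gap[OF that] by simp
  qed
  then show ?thesis
    unfolding almost_uniform_for_large_def by blast
qed

end
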